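(* Let $\lambda\in\mathbb{R}$ and let $y:[0,+\infty)\to\mathbb{R}$. Then $y$ is a solution of the singular third-order ordinary differential equation with initial conditions and integral boundary condition $$y^{(3)}(t)-\lambda^{2}y(t)=\frac{\lambda}{2\sqrt{\pi}}\,\frac{1}{t^{3/2}},\quad t>0,\qquad y(0)=1,\quad y'(0)=0,\quad y^{(2)}(1)=-\frac{\lambda}{\sqrt{\pi}}+\lambda^{2}\int_{0}^{1}y(t)\,dt,$$ if and only if $y$ is a solution of the Volterra integral equation of the second kind $$y(t)=1-\frac{2\lambda}{\sqrt{\pi}}\int_{0}^{t}y(\tau)\sqrt{t-\tau}\,d\tau,\quad t>0.$$
   Context: Here $y^{(n)}$ denotes the $n$-th derivative of $y$. A solution of the differential problem is a function $y\in C^{1}([0,+\infty))\cap C^{3}((0,+\infty))$ satisfying the differential equation for all $t>0$ and the three listed conditions. A solution of the Volterra integral equation is a continuous function $y$ on $[0,+\infty)$ satisfying the equation for all $t>0$. *)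

theory Defs
  imports "HOL-Analysis.Analysis"
begin

text \<open>
  A function on \<open>[0, \<infinity>)\<close> is represented by a total function \<open>real \<Rightarrow> real\<close>; its values on the
  negative reals are arbitrary and must never matter. Hence derivatives at points of \<open>S\<close> are
  taken within \<open>S\<close>: one-sided at \<open>0\<close> for \<open>S = {0..}\<close>, and the ordinary ones if \<open>S\<close> is open.
\<close>

definition C_k_on :: "nat \<Rightarrow> (real \<Rightarrow> real) \<Rightarrow> real set \<Rightarrow> bool" where
  "C_k_on k f S \<longleftrightarrow>
     (\<exists>D :: nat \<Rightarrow> real \<Rightarrow> real.
        (\<forall>x\<in>S. D 0 x = f x) \<and>
        (\<forall>i<k. \<forall>x\<in>S. (D i has_real_derivative D (Suc i) x) (at x within S)) \<and>
        (\<forall>i\<le>k. continuous_on S (D i)))"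

text \<open>
  For \<open>t > 0\<close> the \<open>n\<close>-th derivative \<open>(deriv ^^ n) y t\<close> depends only on \<open>y\<close> near \<open>t\<close>.
  The condition \<open>y'(0) = 0\<close> refers to the right derivative, so it is not expressed by \<open>deriv\<close>.
\<close>

definition is_ode_solution :: "real \<Rightarrow> (real \<Rightarrow> real) \<Rightarrow> bool" where
  "is_ode_solution lam y \<longleftrightarrow>
     C_k_on 1 y {0..} \<and> C_k_on 3 y {0<..} \<and>
     (\<forall>t>0. (deriv ^^ 3) y t - lam\<^sup>2 * y t = lam / (2 * sqrt pi) * (1 / t powr (3 / 2))) \<and>
     y 0 = 1 \<and>
     (y has_real_derivative 0) (at 0 within {0..}) \<and>
     (deriv ^^ 2) y 1 = - lam / sqrt pi + lam\<^sup>2 * integral {0..1} y"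

definition is_volterra_solution :: "real \<Rightarrow> (real \<Rightarrow> real) \<Rightarrow> bool" where
  "is_volterra_solution lam y \<longleftrightarrow>
     continuous_on {0..} y \<and>
     (\<forall>t>0. y t = 1 - 2 * lam / sqrt pi * integral {0..t} (\<lambda>\<tau>. y \<tau> * sqrt (t - \<tau>)))"

end

theory Submission imports Defs begin

text \<open>
  Up to the factor \<open>2 / sqrt pi\<close> the Volterra operator is the fractional integral \<open>J\<close> of order
  \<open>3/2\<close>, so the integral equation reads \<open>y = 1 - lam * J y\<close>. Since \<open>J\<^sup>2\<close> is the threefold
  integral (Fubini and a Beta integral), substituting the equation into itself gives
  \<open>y = 1 - lam * J 1 + lam\<^sup>2 * J\<^sup>2 y\<close>, whose third derivative is the differential equation; the
  boundary condition at \<open>1\<close> fixes the constant lost in \<open>y''\<close>. Conversely, for a solution \<open>y\<close> of the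
  iterated equation the residual \<open>r = y - 1 + lam * J y\<close> satisfies \<open>r = lam * J r\<close> and
  vanishes by Gronwall's inequality.
\<close>

section \<open>Two explicit integrals of square roots\<close>

text \<open>The integrand is the height of the semicircle over the diameter [a, b], so the integral
  is the area of a half-disc. This is the rescaled Beta value B(3/2, 3/2) = pi/8.\<close>

lemma integral_sqrt_mult_sqrt:
  fixes a b :: real
  assumes "a \<le> b"
  shows "integral {a..b} (\<lambda>s. sqrt (b - s) * sqrt (s - a)) = pi * (b - a)\<^sup>2 / 8"
proof (cases "a = b")
  case False
  define m r where "m = (a + b) / 2" and "r = (b - a) / 2"
  have r: "r > 0" using assms False by (simp add: r_def)
  have ab: "a = m - r" "b = m + r" by (simp_all add: m_def r_def field_simps)
  \<comment> \<open>The standard primitive of a semicircle. Since \<open>arcsin\<close> has no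
    finite derivative at -1 and 1, the fundamental theorem is used with differentiability in the
    interior only.\<close>
  define F where "F = (\<lambda>s. ((s - m) * sqrt (r\<^sup>2 - (s - m)\<^sup>2) + r\<^sup>2 * arcsin ((s - m) / r)) / 2)"
  \<comment> \<open>Holds for every real s: \<open>sqrt\<close> is odd, hence multiplicative on all
    reals.\<close>
  have eq: "sqrt (b - s) * sqrt (s - a) = sqrt (r\<^sup>2 - (s - m)\<^sup>2)" for s
    by (simp add: ab real_sqrt_mult[symmetric] power2_eq_square algebra_simps)
  have "((\<lambda>s. sqrt (r\<^sup>2 - (s - m)\<^sup>2)) has_integral (F b - F a)) {a..b}"
  proof (rule fundamental_theorem_of_calculus_interior[OF assms])
    show "continuous_on {a..b} F"
      unfolding F_def using r by (intro continuous_intros) (auto simp: ab field_simps)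
  next
    fix s assume s: "s \<in> {a<..<b}"
    define x where "x = (s - m) / r"
    have x: "-1 < x" "x < 1" and sx: "s - m = r * x" using s r by (auto simp: x_def ab field_simps)
    have x2: "1 - x\<^sup>2 > 0" using x by (simp add: abs_square_less_1 abs_less_iff)
    have w: "r\<^sup>2 - (s - m)\<^sup>2 = r\<^sup>2 * (1 - x\<^sup>2)" by (simp add: sx power_mult_distrib algebra_simps)
    define q where "q = sqrt (1 - x\<^sup>2)"
    have q: "q > 0" "q\<^sup>2 = 1 - x\<^sup>2" using x2 by (auto simp: q_def)
    have w': "sqrt (r\<^sup>2 - (s - m)\<^sup>2) = r * q" using r by (simp add: w real_sqrt_mult q_def)
    have w0: "r\<^sup>2 - (s - m)\<^sup>2 > 0" using r x2 by (simp add: w)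
    have "(F has_real_derivative
        (1 * sqrt (r\<^sup>2 - (s - m)\<^sup>2) + (s - m) * (inverse (sqrt (r\<^sup>2 - (s - m)\<^sup>2)) / 2 * (0 - 2 * (s - m)))
          + r\<^sup>2 * (inverse (sqrt (1 - x\<^sup>2)) * (1 / r))) / 2) (at s)"
      unfolding F_def
      by (rule derivative_eq_intros DERIV_real_sqrt_generic refl | use w0 x r in \<open>force simp: x_def\<close>)+
    also have "(1 * sqrt (r\<^sup>2 - (s - m)\<^sup>2) + (s - m) * (inverse (sqrt (r\<^sup>2 - (s - m)\<^sup>2)) / 2 * (0 - 2 * (s - m)))
          + r\<^sup>2 * (inverse (sqrt (1 - x\<^sup>2)) * (1 / r))) / 2
        = r * (q\<^sup>2 + (1 - x\<^sup>2)) / (2 * q)"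
      unfolding w' unfolding sx q_def[symmetric] using q r by (simp add: field_simps power2_eq_square)
    also have "\<dots> = sqrt (r\<^sup>2 - (s - m)\<^sup>2)"
      unfolding w' q(2)[symmetric] using q(1) by (simp add: power2_eq_square)
    finally show "(F has_vector_derivative sqrt (r\<^sup>2 - (s - m)\<^sup>2)) (at s)"
      by (simp add: has_real_derivative_iff_has_vector_derivative)
  qed
  moreover have "F b - F a = pi * (b - a)\<^sup>2 / 8"
    using r by (simp add: F_def ab field_simps power2_eq_square)
  ultimately show ?thesis by (simp add: eq integral_unique)
qed simp

text \<open>The value of the Volterra kernel on the constant 1. The primitive is -(2/3) (t -
  s)^(3/2), with the power written as a product so that it is continuous up to s = t by the basic
  rules.\<close>

lemma has_integral_sqrt_minus:
  fixes t :: real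
  assumes "t \<ge> 0"
  shows "((\<lambda>s. sqrt (t - s)) has_integral (2 / 3 * t * sqrt t)) {0..t}"
proof -
  define F where "F = (\<lambda>s. - (2 / 3) * ((t - s) * sqrt (t - s)))"
  have "((\<lambda>s. sqrt (t - s)) has_integral (F t - F 0)) {0..t}"
  proof (rule fundamental_theorem_of_calculus_interior[OF assms])
    show "continuous_on {0..t} F"
      unfolding F_def by (intro continuous_intros)
  next
    fix s assume "s \<in> {0<..<t}"
    then have s: "t - s > 0" by simp
    have "(F has_real_derivative
        - (2 / 3) * ((0 - 1) * sqrt (t - s) + (t - s) * (inverse (sqrt (t - s)) / 2 * (0 - 1)))) (at s)"
      unfolding F_def
      by (rule derivative_eq_intros DERIV_real_sqrt_generic refl | use s in force)+
    moreover have "- (2 / 3) * ((0 - 1) * sqrt (t - s) + (t - s) * (inverse (sqrt (t - s)) / 2 * (0 - 1)))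
        = sqrt (t - s)"
    proof -
      have "(t - s) * inverse (sqrt (t - s)) = sqrt (t - s)"
        using real_div_sqrt[of "t - s"] s by (simp only: divide_inverse)
      moreover have "- (2 / 3) * ((0 - 1) * v + w * (i / 2 * (0 - 1))) = 2 / 3 * v + w * i / 3" for v w i :: real
        by (simp add: algebra_simps)
      ultimately show ?thesis by simp
    qed
    ultimately show "(F has_vector_derivative sqrt (t - s)) (at s)"
      by (simp only: has_real_derivative_iff_has_vector_derivative)
  qed
  then show ?thesis by (simp add: F_def mult.assoc)
qed

section \<open>Calculus on the half-line and Gronwall's inequality\<close>

lemma has_real_derivative_integral_atLeast:
  fixes f :: "real \<Rightarrow> real"
  assumes "continuous_on {0..} f" "t \<ge> 0"
  shows "((\<lambda>x. integral {0..x} f) has_real_derivative f t) (at t within {0..})"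
proof -
  \<comment> \<open>The endpoint t + 1 keeps t away from the right end of the compact interval, so
    derivatives within it and within the half-line agree at t.\<close>
  have "((\<lambda>x. integral {0..x} f) has_real_derivative f t) (at t within {0..t+1})"
    using assms by (intro integral_has_real_derivative continuous_on_subset[OF assms(1)]) auto
  moreover have "at t within {0..t+1} = at t within {0..}"
    by (rule at_within_nhd[of _ "{..<t+1}"]) auto
  ultimately show ?thesis by simp
qed

lemma at_within_atLeast_eq_at: "at t within {0..} = at t" if "t > 0" for t :: real
  using that by (intro at_within_interior) simp

text \<open>Continuity carries the initial value into the open half-line, where the difference is
  constant. Derivatives that blow up at 0 are thus allowed.\<close>

lemma eq_if_same_derivative:
  fixes f g :: "real \<Rightarrow> real"
  assumes "continuous_on {0..} f" "continuous_on {0..} g" "f 0 = g 0"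
    and "\<And>t. t > 0 \<Longrightarrow> (f has_real_derivative d t) (at t)"
    and "\<And>t. t > 0 \<Longrightarrow> (g has_real_derivative d t) (at t)"
    and "t \<ge> 0"
  shows "f t = g t"
proof (cases "t = 0")
  case False
  have "f t - g t = f 0 - g 0"
  proof (rule DERIV_isconst_end[where f = "\<lambda>t. f t - g t"])
    show "0 < t" using False \<open>t \<ge> 0\<close> by simp
    show "continuous_on {0..t} (\<lambda>t. f t - g t)"
      by (intro continuous_on_diff continuous_on_subset[OF assms(1)] continuous_on_subset[OF assms(2)]) auto
    show "((\<lambda>t. f t - g t) has_real_derivative 0) (at x)" if "0 < x" for x
      using DERIV_diff[OF assms(4,5)[OF that]] by simp
  qed
  then show ?thesis using assms(3) by simp
qed (use assms in simp)

text \<open>For u(t) the integral of |r| over [0, t], the bound makes u(t) exp(-K t) nonincreasing;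
  it starts at 0 and u is nonnegative, so u(T) = 0. The bound is asked for on [0, T] only, so K may
  depend on T.\<close>

lemma gronwall_zero:
  fixes r :: "real \<Rightarrow> real"
  assumes cont: "continuous_on {0..} r"
    and bound: "\<And>s. 0 \<le> s \<Longrightarrow> s \<le> T \<Longrightarrow> \<bar>r s\<bar> \<le> K * integral {0..s} (\<lambda>\<tau>. \<bar>r \<tau>\<bar>)"
    and "0 \<le> T"
  shows "r T = 0"
proof -
  define u where "u = (\<lambda>t. integral {0..t} (\<lambda>\<tau>. \<bar>r \<tau>\<bar>))"
  have cont': "continuous_on {0..} (\<lambda>\<tau>. \<bar>r \<tau>\<bar>)" by (intro continuous_intros cont)
  have du: "(u has_real_derivative \<bar>r t\<bar>) (at t within {0..})" if "t \<ge> 0" for t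
    unfolding u_def using cont' that by (rule has_real_derivative_integral_atLeast)
  have "continuous_on {0..} u"
    by (rule DERIV_continuous_on[OF du]) simp
  then have contu: "continuous_on {0..T} u" by (rule continuous_on_subset) auto
  have "u 0 * exp (- K * 0) \<ge> u T * exp (- K * T)"
  proof (rule DERIV_nonpos_imp_decreasing_open[OF \<open>0 \<le> T\<close>])
    show "continuous_on {0..T} (\<lambda>t. u t * exp (- K * t))"
      by (intro continuous_intros contu)
    fix x assume x: "0 < x" "x < T"
    have "(u has_real_derivative \<bar>r x\<bar>) (at x)"
      using du[of x] x by (simp add: at_within_atLeast_eq_at)
    then have "((\<lambda>t. u t * exp (- K * t)) has_real_derivative (\<bar>r x\<bar> - K * u x) * exp (- K * x)) (at x)"
      by (auto intro!: derivative_eq_intros simp: algebra_simps)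
    moreover have "(\<bar>r x\<bar> - K * u x) * exp (- K * x) \<le> 0"
      using bound[of x] x by (intro mult_nonpos_nonneg) (auto simp: u_def)
    ultimately show "\<exists>y. ((\<lambda>t. u t * exp (- K * t)) has_real_derivative y) (at x) \<and> y \<le> 0" by blast
  qed
  then have "u T \<le> 0" by (simp add: u_def mult_le_0_iff)
  moreover have "u T \<ge> 0" unfolding u_def
    by (intro integral_nonneg integrable_continuous_interval continuous_on_subset[OF cont']) auto
  ultimately show ?thesis using bound[of T] \<open>0 \<le> T\<close> by (simp add: u_def)
qed

section \<open>The Volterra operator and its square\<close>

text \<open>The Riemann-Liouville integral J of order 3/2 without its factor 1 / Gamma(3/2) = 2 /
  sqrt pi.\<close>

definition sqrt_int :: "(real \<Rightarrow> real) \<Rightarrow> real \<Rightarrow> real" where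
  "sqrt_int y t = integral {0..t} (\<lambda>\<tau>. y \<tau> * sqrt (t - \<tau>))"

text \<open>Cauchy's formula for the threefold integral from 0.\<close>

definition triple_int :: "(real \<Rightarrow> real) \<Rightarrow> real \<Rightarrow> real" where
  "triple_int y t = integral {0..t} (\<lambda>\<tau>. y \<tau> * (t - \<tau>)\<^sup>2) / 2"

lemma sqrt_int_integrable:
  assumes "continuous_on {0..} y"
  shows "(\<lambda>\<tau>. y \<tau> * sqrt (t - \<tau>)) integrable_on {0..t}"
  by (intro integrable_continuous_interval continuous_intros continuous_on_subset[OF assms]) auto

text \<open>
  With \<open>max\<close> the kernel extends continuously to the whole square, so that Fubini on a triangle
  becomes Fubini on a box; \<open>sqrt\<close> alone would be odd instead of zero on the negative reals.
\<close>

lemma sqrt_int_eq_truncated: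
  assumes "s \<le> t"
  shows "sqrt_int y s = integral {0..t} (\<lambda>\<tau>. y \<tau> * sqrt (max 0 (s - \<tau>)))"
proof -
  have "sqrt_int y s = integral {0..s} (\<lambda>\<tau>. y \<tau> * sqrt (max 0 (s - \<tau>)))"
    unfolding sqrt_int_def by (rule integral_cong) auto
  also have "\<dots> = integral {0..t} (\<lambda>\<tau>. y \<tau> * sqrt (max 0 (s - \<tau>)))"
    using assms by (intro integral_spike_set) (auto intro: negligible_subset[of "{}"])
  finally show ?thesis .
qed

lemma continuous_on_sqrt_int:
  assumes "continuous_on {0..} y"
  shows "continuous_on {0..} (sqrt_int y)"
proof -
  \<comment> \<open>The truncated form has a fixed domain of integration, so continuity in the
    parameter applies. For negative s both forms are 0.\<close>
  have "continuous_on {..<T} (sqrt_int y)" for T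
  proof -
    have "continuous_on {..<T} (\<lambda>s. integral (cbox 0 T) (\<lambda>\<tau>. y \<tau> * sqrt (max 0 (s - \<tau>))))"
    proof (rule integral_continuous_on_param)
      have "continuous_on ({..<T} \<times> cbox 0 T) (\<lambda>p. y (snd p))"
        by (rule continuous_on_compose2[OF assms]) (auto intro!: continuous_intros)
      then show "continuous_on ({..<T} \<times> cbox 0 T) (\<lambda>(s, \<tau>). y \<tau> * sqrt (max 0 (s - \<tau>)))"
        by (auto intro!: continuous_intros simp: case_prod_unfold)
    qed
    then show ?thesis
      by (rule continuous_on_eq) (simp add: sqrt_int_eq_truncated[of _ T])
  qed
  then have "isCont (sqrt_int y) t" for t
    by (metis continuous_on_eq_continuous_at lessThan_iff lt_ex open_lessThan gt_ex)
  then show ?thesis by (simp add: continuous_at_imp_continuous_on)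
qed

text \<open>After Fubini the inner integral is the half-disc area pi (t - \<tau>)^2 / 8; the 2 in
  \<open>triple_int\<close> turns pi / 8 into pi / 4.\<close>

lemma sqrt_int_sqrt_int:
  assumes cont: "continuous_on {0..} y" and "t \<ge> 0"
  shows "sqrt_int (sqrt_int y) t = pi / 4 * triple_int y t"
proof -
  have "sqrt_int (sqrt_int y) t
      = integral (cbox 0 t) (\<lambda>s. integral (cbox 0 t) (\<lambda>\<tau>. y \<tau> * sqrt (max 0 (s - \<tau>)) * sqrt (t - s)))"
    unfolding sqrt_int_def[of "sqrt_int y"] box_real
    by (rule integral_cong) (simp add: sqrt_int_eq_truncated[of _ t])
  also have "\<dots> = integral (cbox 0 t) (\<lambda>\<tau>. integral (cbox 0 t) (\<lambda>s. y \<tau> * sqrt (max 0 (s - \<tau>)) * sqrt (t - s)))"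
  proof (rule integral_swap_continuous)
    have "continuous_on (cbox (0, 0) (t, t)) (\<lambda>p. y (snd p))"
      by (rule continuous_on_compose2[OF cont]) (auto intro!: continuous_intros simp: cbox_Pair_eq)
    then show "continuous_on (cbox (0, 0) (t, t)) (\<lambda>(s, \<tau>). y \<tau> * sqrt (max 0 (s - \<tau>)) * sqrt (t - s))"
      by (auto intro!: continuous_intros simp: case_prod_unfold)
  qed
  also have "\<dots> = integral {0..t} (\<lambda>\<tau>. pi / 8 * (y \<tau> * (t - \<tau>)\<^sup>2))"
    unfolding box_real
  proof (rule integral_cong)
    fix \<tau> assume \<tau>: "\<tau> \<in> {0..t}"
    have "integral {0..t} (\<lambda>s. sqrt (max 0 (s - \<tau>)) * sqrt (t - s))
        = integral {\<tau>..t} (\<lambda>s. sqrt (max 0 (s - \<tau>)) * sqrt (t - s))"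
      using \<tau> by (intro integral_spike_set) (auto intro: negligible_subset[of "{}"])
    also have "\<dots> = integral {\<tau>..t} (\<lambda>s. sqrt (t - s) * sqrt (s - \<tau>))"
      by (rule integral_cong) auto
    also have "\<dots> = pi * (t - \<tau>)\<^sup>2 / 8"
      using \<tau> by (intro integral_sqrt_mult_sqrt) simp
    finally show "integral {0..t} (\<lambda>s. y \<tau> * sqrt (max 0 (s - \<tau>)) * sqrt (t - s)) = pi / 8 * (y \<tau> * (t - \<tau>)\<^sup>2)"
      by (simp add: mult.assoc)
  qed
  finally show ?thesis by (simp add: triple_int_def)
qed

text \<open>Linearity, with the known values on 1 and on \<open>sqrt_int f\<close>. The shape covers
  both the right-hand side of the Volterra equation and the residual.\<close>

lemma sqrt_int_lincomb:
  assumes f: "continuous_on {0..} f" and "t \<ge> 0"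
  shows "sqrt_int (\<lambda>s. a + b * f s + c * sqrt_int f s) t
    = a * (2 / 3 * t * sqrt t) + b * sqrt_int f t + c * (pi / 4 * triple_int f t)"
proof -
  note int = sqrt_int_integrable[OF f, of t] sqrt_int_integrable[OF continuous_on_sqrt_int[OF f], of t]
  have "((\<lambda>\<tau>. a * sqrt (t - \<tau>) + b * (f \<tau> * sqrt (t - \<tau>)) + c * (sqrt_int f \<tau> * sqrt (t - \<tau>)))
      has_integral a * (2 / 3 * t * sqrt t) + b * sqrt_int f t + c * sqrt_int (sqrt_int f) t) {0..t}"
    unfolding sqrt_int_def[of _ t]
    by (intro has_integral_add has_integral_mult_right has_integral_sqrt_minus int[THEN integrable_integral] assms)
  then show ?thesis
    unfolding sqrt_int_sqrt_int[OF assms] sqrt_int_def[of "\<lambda>s. a + b * f s + c * sqrt_int f s"]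
    by (intro integral_unique) (simp add: algebra_simps)
qed

section \<open>Derivatives of the threefold integral\<close>

text \<open>Expanding the square takes t out of the integrands, so that the product rule and the
  fundamental theorem replace differentiation under the integral sign.\<close>

lemma triple_int_eq_moments:
  assumes "continuous_on {0..} y"
  shows "triple_int y t = (t\<^sup>2 * integral {0..t} y - 2 * t * integral {0..t} (\<lambda>\<tau>. \<tau> * y \<tau>)
    + integral {0..t} (\<lambda>\<tau>. \<tau>\<^sup>2 * y \<tau>)) / 2"
proof -
  have y: "continuous_on {0..t} y" by (rule continuous_on_subset[OF assms]) auto
  have "y integrable_on {0..t}" "(\<lambda>\<tau>. \<tau> * y \<tau>) integrable_on {0..t}" "(\<lambda>\<tau>. \<tau>\<^sup>2 * y \<tau>) integrable_on {0..t}"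
    by (intro integrable_continuous_interval continuous_intros y)+
  note int = this[THEN integrable_integral]
  have "((\<lambda>\<tau>. t\<^sup>2 * y \<tau> - 2 * t * (\<tau> * y \<tau>) + \<tau>\<^sup>2 * y \<tau>) has_integral
      t\<^sup>2 * integral {0..t} y - 2 * t * integral {0..t} (\<lambda>\<tau>. \<tau> * y \<tau>)
    + integral {0..t} (\<lambda>\<tau>. \<tau>\<^sup>2 * y \<tau>)) {0..t}"
    by (intro has_integral_add has_integral_diff has_integral_mult_right int)
  moreover have "t\<^sup>2 * y \<tau> - 2 * t * (\<tau> * y \<tau>) + \<tau>\<^sup>2 * y \<tau> = y \<tau> * (t - \<tau>)\<^sup>2" for \<tau>
    by (simp add: power2_eq_square algebra_simps)
  ultimately show ?thesis by (simp add: triple_int_def integral_unique)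
qed

text \<open>The twofold integral, with kernel t - \<tau>, already expanded into moments.\<close>

definition double_int :: "(real \<Rightarrow> real) \<Rightarrow> real \<Rightarrow> real" where
  "double_int y t = t * integral {0..t} y - integral {0..t} (\<lambda>\<tau>. \<tau> * y \<tau>)"

lemma has_real_derivative_double_int:
  assumes "continuous_on {0..} y" "t \<ge> 0"
  shows "(double_int y has_real_derivative integral {0..t} y) (at t within {0..})"
proof -
  have 1: "continuous_on {0..} (\<lambda>\<tau>. \<tau> * y \<tau>)" by (intro continuous_intros assms)
  show ?thesis unfolding double_int_def
    by (rule derivative_eq_intros has_real_derivative_integral_atLeast[OF assms]
        has_real_derivative_integral_atLeast[OF 1 assms(2)] refl | simp)+
qed

lemma has_real_derivative_triple_int:
  assumes "continuous_on {0..} y" "t \<ge> 0"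
  shows "(triple_int y has_real_derivative double_int y t) (at t within {0..})"
proof -
  have 1: "continuous_on {0..} (\<lambda>\<tau>. \<tau> * y \<tau>)" "continuous_on {0..} (\<lambda>\<tau>. \<tau>\<^sup>2 * y \<tau>)"
    by (intro continuous_intros assms)+
  note A = has_real_derivative_integral_atLeast[OF assms]
    and B = 1[THEN has_real_derivative_integral_atLeast, OF assms(2)]
  have "((\<lambda>t::real. t\<^sup>2) has_real_derivative 2 * t) (at t within {0..})"
    "((\<lambda>t::real. 2 * t) has_real_derivative 2) (at t within {0..})"
    by (auto intro!: derivative_eq_intros)
  \<comment> \<open>The contributions t^2 y(t), -2 t^2 y(t) and t^2 y(t) of the three upper limits
    cancel.\<close>
  note D = DERIV_cdivide[OF DERIV_add[OF DERIV_diff[OF DERIV_mult[OF this(1) A] DERIV_mult[OF this(2) B(1)]] B(2)], of 2]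
  show ?thesis unfolding triple_int_eq_moments[OF assms(1), abs_def]
    by (rule DERIV_cong[OF D]) (simp add: double_int_def power2_eq_square field_simps)
qed

section \<open>Equivalence of the Volterra equation and the iterated equation\<close>

text \<open>The iterated equation \<open>y = 1 - lam * J 1 + lam\<^sup>2 * J\<^sup>2 y\<close>.\<close>

definition is_iterated_solution :: "real \<Rightarrow> (real \<Rightarrow> real) \<Rightarrow> bool" where
  "is_iterated_solution lam y \<longleftrightarrow> continuous_on {0..} y \<and>
    (\<forall>t\<ge>0. y t = 1 - 4 * lam / (3 * sqrt pi) * (t * sqrt t) + lam\<^sup>2 * triple_int y t)"

text \<open>On [0, T] the kernel is at most sqrt T, so Gronwall applies with K = |c| sqrt T,
  whatever the sign of c.\<close>

lemma sqrt_int_fixpoint_zero: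
  assumes r: "continuous_on {0..} r" and eq: "\<And>t. t \<ge> 0 \<Longrightarrow> r t = c * sqrt_int r t" and "T \<ge> 0"
  shows "r T = 0"
proof (rule gronwall_zero[OF r _ \<open>T \<ge> 0\<close>])
  fix s assume s: "0 \<le> s" "s \<le> T"
  have r': "continuous_on {0..s} r" by (rule continuous_on_subset[OF r]) auto
  have "\<bar>sqrt_int r s\<bar> \<le> integral {0..s} (\<lambda>\<tau>. sqrt T * \<bar>r \<tau>\<bar>)"
    unfolding sqrt_int_def real_norm_def[symmetric]
  proof (rule integral_norm_bound_integral)
    show "norm (r \<tau> * sqrt (s - \<tau>)) \<le> sqrt T * norm (r \<tau>)" if "\<tau> \<in> {0..s}" for \<tau>
    proof -
      have "sqrt (s - \<tau>) \<le> sqrt T" using that s by simp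
      from mult_right_mono[OF this, of "\<bar>r \<tau>\<bar>"] show ?thesis
        using that by (simp add: abs_mult mult.commute)
    qed
  qed (intro integrable_continuous_interval continuous_intros r')+
  also have "\<dots> = sqrt T * integral {0..s} (\<lambda>\<tau>. \<bar>r \<tau>\<bar>)" by simp
  finally have "\<bar>sqrt_int r s\<bar> \<le> sqrt T * integral {0..s} (\<lambda>\<tau>. \<bar>r \<tau>\<bar>)" .
  from mult_left_mono[OF this, of "\<bar>c\<bar>"]
  show "\<bar>r s\<bar> \<le> \<bar>c\<bar> * sqrt T * integral {0..s} (\<lambda>\<tau>. \<bar>r \<tau>\<bar>)"
    by (simp add: eq[OF s(1)] abs_mult mult.assoc)
qed

text \<open>Both sides are continuous on the closed half-line, so the equation extends from t > 0 to
  t = 0, where it yields y(0) = 1.\<close>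

lemma volterra_iff_sqrt_int:
  "is_volterra_solution lam y \<longleftrightarrow> continuous_on {0..} y \<and>
     (\<forall>t\<ge>0. y t = 1 - 2 * lam / sqrt pi * sqrt_int y t)" (is "?L \<longleftrightarrow> ?R")
proof
  assume ?R then show ?L by (simp add: is_volterra_solution_def sqrt_int_def)
next
  assume L: ?L
  then have y: "continuous_on {0..} y" by (simp add: is_volterra_solution_def)
  define g where "g = (\<lambda>t. 1 - 2 * lam / sqrt pi * sqrt_int y t)"
  have g: "continuous_on {0..} g" unfolding g_def
    by (intro continuous_intros continuous_on_sqrt_int y)
  have eq: "y t = g t" if "t > 0" for t
    using L that by (simp add: is_volterra_solution_def g_def sqrt_int_def)
  have "y t = g t" if "t \<ge> 0" for t
  proof -
    have "continuous_on (closure {0<..}) (\<lambda>t. y t - g t)" by (simp add: y g continuous_on_diff)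
    from continuous_constant_on_closure[OF this, of 0 t] show ?thesis using eq that by simp
  qed
  then show ?R using y by (simp add: g_def)
qed

lemma volterra_iff_iterated: "is_volterra_solution lam y \<longleftrightarrow> is_iterated_solution lam y"
proof -
  \<comment> \<open>The normalising factors multiply to 1, leaving lam^2 in front of
    \<open>triple_int\<close>.\<close>
  have c: "(2 * lam / sqrt pi)\<^sup>2 * (pi / 4) = lam\<^sup>2"
    by (simp add: power_divide power_mult_distrib)
  let ?c = "2 * lam / sqrt pi"
  show ?thesis
  proof
    assume "is_volterra_solution lam y"
    then have y: "continuous_on {0..} y" and eq: "\<And>t. t \<ge> 0 \<Longrightarrow> y t = 1 - ?c * sqrt_int y t"
      by (auto simp: volterra_iff_sqrt_int)
    have "y t = 1 - 4 * lam / (3 * sqrt pi) * (t * sqrt t) + lam\<^sup>2 * triple_int y t" if t: "t \<ge> 0" for t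
    proof -
      \<comment> \<open>The summand \<open>0 * y s\<close> only brings the right-hand side into the
        shape of \<open>sqrt_int_lincomb\<close>.\<close>
      have "sqrt_int y t = sqrt_int (\<lambda>s. 1 + 0 * y s + (- ?c) * sqrt_int y s) t"
        unfolding sqrt_int_def[of _ t] by (rule integral_cong) (simp add: eq)
      also have "\<dots> = 2 / 3 * t * sqrt t - ?c * (pi / 4 * triple_int y t)"
        by (subst sqrt_int_lincomb[OF y t]) simp
      finally have "y t = 1 - ?c * (2 / 3 * t * sqrt t - ?c * (pi / 4 * triple_int y t))"
        by (subst eq[OF t]) simp
      then show ?thesis unfolding c[symmetric] by (simp add: power2_eq_square algebra_simps)
    qed
    then show "is_iterated_solution lam y" using y by (simp add: is_iterated_solution_def)
  next
    assume "is_iterated_solution lam y"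
    then have y: "continuous_on {0..} y"
      and eq: "\<And>t. t \<ge> 0 \<Longrightarrow> y t = 1 - 4 * lam / (3 * sqrt pi) * (t * sqrt t) + lam\<^sup>2 * triple_int y t"
      by (auto simp: is_iterated_solution_def)
    define r where "r = (\<lambda>t. - 1 + 1 * y t + ?c * sqrt_int y t)"
    have r: "continuous_on {0..} r" unfolding r_def
      by (intro continuous_intros continuous_on_sqrt_int y)
    \<comment> \<open>By the iterated equation, \<open>?c * sqrt_int\<close> sends the part -1 +
      \<open>?c * sqrt_int y\<close> of r to y - 1, and the part y to
      \<open>?c * sqrt_int y\<close>.\<close>
    have "r t = ?c * sqrt_int r t" if t: "t \<ge> 0" for t
      unfolding r_def sqrt_int_lincomb[OF y t]
      by (subst eq[OF t], unfold c[symmetric]) (simp add: power2_eq_square algebra_simps)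
    then have "r t = 0" if "t \<ge> 0" for t
      by (rule sqrt_int_fixpoint_zero[OF r _ that])
    then show "is_volterra_solution lam y"
      using y by (auto simp: volterra_iff_sqrt_int r_def algebra_simps)
  qed
qed


section \<open>Derivatives of the right-hand side of the iterated equation\<close>

text \<open>At 0 the product rule fails because \<open>sqrt\<close> is not differentiable there, but
  the difference quotient is \<open>sqrt x\<close> itself.\<close>

lemma has_real_derivative_mult_sqrt:
  assumes "t \<ge> 0"
  shows "((\<lambda>t. t * sqrt t) has_real_derivative 3 / 2 * sqrt t) (at t within {0..})"
proof (cases "t = 0")
  case True
  have "((\<lambda>x. x * sqrt x) has_real_derivative sqrt 0) (at 0 within {0..})"
    unfolding has_field_derivative_iff
  proof (rule Lim_transform_eventually)
    show "(sqrt \<longlongrightarrow> sqrt 0) (at 0 within {0..})" by (intro tendsto_intros)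
    show "\<forall>\<^sub>F x in at 0 within {0..}. sqrt x = (x * sqrt x - 0 * sqrt 0) / (x - 0)"
      by (auto simp: eventually_at_filter)
  qed
  then show ?thesis using True by simp
next
  case False
  then have t: "t > 0" using assms by simp
  have "t * inverse (sqrt t) = sqrt t"
    using real_div_sqrt[of t] t by (simp only: divide_inverse)
  then have "1 * sqrt t + inverse (sqrt t) / 2 * t = 3 / 2 * sqrt t" by (simp add: mult.commute)
  with DERIV_mult[OF DERIV_ident DERIV_real_sqrt[OF t]] show ?thesis
    by (simp only: at_within_atLeast_eq_at[OF t])
qed

text \<open>Links the witnesses of \<open>C_k_on\<close> to iterated \<open>deriv\<close>. Openness
  of S drives the induction: equality near x suffices to transfer a derivative.\<close>

lemma deriv_pow_eq:
  assumes "open S" and "\<And>i x. i < k \<Longrightarrow> x \<in> S \<Longrightarrow> (D i has_real_derivative D (Suc i) x) (at x)"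
    and "\<And>x. x \<in> S \<Longrightarrow> D 0 x = f x" and "n \<le> k" "x \<in> S"
  shows "(deriv ^^ n) f x = D n x"
  using assms(4,5)
proof (induction n arbitrary: x)
  case (Suc n)
  have "((deriv ^^ n) f has_real_derivative D (Suc n) x) (at x)"
    by (rule has_field_derivative_transform_within_open[OF assms(2) assms(1)]) (use Suc in auto)
  then show ?case by (simp add: DERIV_imp_deriv)
qed (use assms(3) in simp)

lemma powr_three_halves: "t powr (3 / 2) = t * sqrt t" if "t > 0" for t :: real
proof -
  have "t powr (1 + 1 / 2) = t powr 1 * t powr (1 / 2)" by (rule powr_add)
  then show ?thesis using that by (simp add: powr_half_sqrt)
qed

text \<open>The right-hand side of the iterated equation and its formal derivatives up to order 3.\<close>

definition iterated_deriv :: "real \<Rightarrow> (real \<Rightarrow> real) \<Rightarrow> nat \<Rightarrow> real \<Rightarrow> real" where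
  "iterated_deriv lam y n t =
    (if n = 0 then 1 - 4 * lam / (3 * sqrt pi) * (t * sqrt t) + lam\<^sup>2 * triple_int y t
     else if n = 1 then - 2 * lam / sqrt pi * sqrt t + lam\<^sup>2 * double_int y t
     else if n = 2 then - lam / sqrt pi / sqrt t + lam\<^sup>2 * integral {0..t} y
     else lam / (2 * sqrt pi) * (1 / t powr (3 / 2)) + lam\<^sup>2 * y t)"

lemma iterated_deriv_simps:
  "iterated_deriv lam y 0 = (\<lambda>t. 1 - 4 * lam / (3 * sqrt pi) * (t * sqrt t) + lam\<^sup>2 * triple_int y t)"
  "iterated_deriv lam y 1 = (\<lambda>t. - 2 * lam / sqrt pi * sqrt t + lam\<^sup>2 * double_int y t)"
  "iterated_deriv lam y 2 = (\<lambda>t. - lam / sqrt pi * inverse (sqrt t) + lam\<^sup>2 * integral {0..t} y)"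
  "iterated_deriv lam y 3 = (\<lambda>t. lam / (2 * sqrt pi) * (1 / t powr (3 / 2)) + lam\<^sup>2 * y t)"
  by (auto simp: iterated_deriv_def inverse_eq_divide)

text \<open>One-sided at 0, as the C^1 condition and y'(0) = 0 demand. The next derivative contains
  1 / sqrt t and is treated for t > 0 only.\<close>

lemma iterated_deriv_0:
  assumes "continuous_on {0..} y" "t \<ge> 0"
  shows "(iterated_deriv lam y 0 has_real_derivative iterated_deriv lam y 1 t) (at t within {0..})"
proof -
  note D = DERIV_add[OF DERIV_diff[OF DERIV_const DERIV_cmult[OF has_real_derivative_mult_sqrt[OF assms(2)]]]
      DERIV_cmult[OF has_real_derivative_triple_int[OF assms]]]
  show ?thesis
    unfolding iterated_deriv_simps by (rule DERIV_cong[OF D]) simp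
qed

lemma iterated_deriv_Suc:
  assumes y: "continuous_on {0..} y" and t: "t > 0" and "n < 3"
  shows "(iterated_deriv lam y n has_real_derivative iterated_deriv lam y (Suc n) t) (at t)"
proof -
  have t0: "t \<ge> 0" using t by simp
  note dy = iterated_deriv_0[OF y t0] has_real_derivative_double_int[OF y t0]
    has_real_derivative_integral_atLeast[OF y t0]
  note dy = dy[unfolded at_within_atLeast_eq_at[OF t]]
  note sq = DERIV_real_sqrt[OF t]
  consider "n = 0" | "n = 1" | "n = 2" using \<open>n < 3\<close> by linarith
  then show ?thesis
  proof cases
    case 1
    then show ?thesis using dy(1) by simp
  next
    case 2
    have "(iterated_deriv lam y 1 has_real_derivative iterated_deriv lam y 2 t) (at t)"
      unfolding iterated_deriv_simps
      by (rule DERIV_cong[OF DERIV_add[OF DERIV_cmult[OF sq] DERIV_cmult[OF dy(2)]]]) simp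
    then show ?thesis by (simp only: 2 Suc_1)
  next
    case 3
    have *: "inverse (sqrt t) * inverse (sqrt t) * inverse (sqrt t) = 1 / (t * sqrt t)"
    proof -
      have "inverse q * inverse q * inverse q = 1 / (q * q * q)" for q :: real
        by (simp add: inverse_eq_divide)
      from this[of "sqrt t"] show ?thesis using t by simp
    qed
    have "sqrt t \<noteq> 0" using t by simp
    have "(iterated_deriv lam y 2 has_real_derivative iterated_deriv lam y 3 t) (at t)"
      unfolding iterated_deriv_simps powr_three_halves[OF t]
      by (rule DERIV_cong[OF DERIV_add[OF
            DERIV_cmult[OF DERIV_inverse'[OF sq \<open>sqrt t \<noteq> 0\<close>]] DERIV_cmult[OF dy(3)]]])
        (simp add: *)
    then show ?thesis by (simp only: 3 eval_nat_numeral BitM.simps One_nat_def)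
  qed
qed

lemma continuous_on_iterated_deriv:
  assumes "continuous_on {0..} y"
  shows "n \<le> 1 \<Longrightarrow> continuous_on {0..} (iterated_deriv lam y n)"
    and "n \<le> 3 \<Longrightarrow> continuous_on {0<..} (iterated_deriv lam y n)"
proof -
  have y: "continuous_on {0<..} y" by (rule continuous_on_subset[OF assms]) auto
  have d: "continuous_on {0..} (double_int y)"
    by (rule DERIV_continuous_on[OF has_real_derivative_double_int[OF assms]]) simp
  have 0: "continuous_on {0..} (iterated_deriv lam y 0)"
    by (rule DERIV_continuous_on[OF iterated_deriv_0[OF assms]]) simp
  have 1: "continuous_on {0..} (iterated_deriv lam y 1)"
    unfolding iterated_deriv_simps using d by (auto intro!: continuous_intros)
  show "n \<le> 1 \<Longrightarrow> continuous_on {0..} (iterated_deriv lam y n)"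
    using 0 1 by (metis le_neq_implies_less less_one)
  show "continuous_on {0<..} (iterated_deriv lam y n)" if "n \<le> 3"
  proof (cases "n = 3")
    case True
    show ?thesis unfolding True iterated_deriv_simps
      using y by (auto intro!: continuous_intros)
  next
    case False
    with that have "n < 3" by simp
    show ?thesis
    proof (rule DERIV_continuous_on)
      fix t :: real assume "t \<in> {0<..}"
      then have "t > 0" by simp
      from iterated_deriv_Suc[OF assms this \<open>n < 3\<close>]
      show "(iterated_deriv lam y n has_real_derivative iterated_deriv lam y (Suc n) t) (at t within {0<..})"
        by (rule has_field_derivative_at_within)
    qed
  qed
qed

section \<open>Equivalence of the iterated equation and the differential problem\<close>

text \<open>The functions \<open>iterated_deriv lam y n\<close> witness both regularity conditions;
  n = 3 is the differential equation, and n = 2 at t = 1 the boundary condition.\<close>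

lemma iterated_imp_ode:
  assumes "is_iterated_solution lam y"
  shows "is_ode_solution lam y"
proof -
  have y: "continuous_on {0..} y" and eq: "\<And>t. t \<ge> 0 \<Longrightarrow> iterated_deriv lam y 0 t = y t"
    using assms by (auto simp: is_iterated_solution_def iterated_deriv_def)
  note D = iterated_deriv_Suc[OF y]
  have der: "(deriv ^^ n) y t = iterated_deriv lam y n t" if "n \<le> 3" "t > 0" for n t
    using that D eq by (intro deriv_pow_eq[of "{0<..}" 3]) auto
  have "C_k_on 1 y {0..}"
    unfolding C_k_on_def using eq iterated_deriv_0[OF y] continuous_on_iterated_deriv(1)[OF y]
    by (intro exI[of _ "iterated_deriv lam y"]) auto
  moreover have "C_k_on 3 y {0<..}"
    unfolding C_k_on_def using eq D continuous_on_iterated_deriv(2)[OF y]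
    by (intro exI[of _ "iterated_deriv lam y"]) (auto intro: has_field_derivative_at_within)
  moreover have "y 0 = 1"
    using eq[of 0] by (simp add: iterated_deriv_def triple_int_def)
  moreover have "(y has_real_derivative 0) (at 0 within {0..})"
  proof -
    have "(iterated_deriv lam y 0 has_real_derivative 0) (at 0 within {0..})"
      using iterated_deriv_0[OF y, of 0 lam] by (simp add: iterated_deriv_def[of _ _ "Suc 0"] double_int_def)
    \<comment> \<open>Agreement with \<open>y\<close> is known on \<open>{0..}\<close> only, so the
      derivative is transferred within that set.\<close>
    then show ?thesis
      unfolding has_field_derivative_def by (rule has_derivative_transform[rotated 2]) (simp_all add: eq)
  qed
  ultimately show ?thesis
    by (simp add: is_ode_solution_def der iterated_deriv_def del: funpow.simps)
qed

text \<open>The derivatives of y are identified with the formal ones from order 3 downwards. Each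
  integration constant is fixed by one condition: order 2 by the one at t = 1, order 1 by y'(0) = 0,
  order 0 by y(0) = 1.\<close>

lemma ode_imp_iterated:
  assumes "is_ode_solution lam y"
  shows "is_iterated_solution lam y"
proof -
  from assms have "C_k_on 1 y {0..}" by (simp add: is_ode_solution_def)
  then obtain D :: "nat \<Rightarrow> real \<Rightarrow> real"
    where D: "\<And>t. t \<ge> 0 \<Longrightarrow> D 0 t = y t"
        "\<And>t. t \<ge> 0 \<Longrightarrow> (D 0 has_real_derivative D 1 t) (at t within {0..})"
        "continuous_on {0..} (D 0)" "continuous_on {0..} (D 1)"
    unfolding C_k_on_def by auto
  from assms have "C_k_on 3 y {0<..}" by (simp add: is_ode_solution_def)
  then obtain E :: "nat \<Rightarrow> real \<Rightarrow> real"
    where E: "\<And>t. t > 0 \<Longrightarrow> E 0 t = y t"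
        "\<And>i t. i < 3 \<Longrightarrow> t > 0 \<Longrightarrow> (E i has_real_derivative E (Suc i) t) (at t)"
    unfolding C_k_on_def
    by (auto simp: at_within_open[OF _ open_greaterThan])
  have ode: "\<And>t. t > 0 \<Longrightarrow> (deriv ^^ 3) y t - lam\<^sup>2 * y t = lam / (2 * sqrt pi) * (1 / t powr (3 / 2))"
    and y0: "y 0 = 1" "(y has_real_derivative 0) (at 0 within {0..})"
    and bc: "(deriv ^^ 2) y 1 = - lam / sqrt pi + lam\<^sup>2 * integral {0..1} y"
    using assms by (auto simp: is_ode_solution_def simp del: funpow.simps)
  have y: "continuous_on {0..} y" using D(1,3) by (auto intro: continuous_on_eq)
  let ?R = "iterated_deriv lam y"
  note R = iterated_deriv_Suc[OF y]
  have der: "(deriv ^^ n) y t = E n t" if "n \<le> 3" "t > 0" for n t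
    using that E by (intro deriv_pow_eq[of "{0<..}" 3]) auto
  have E3: "E 3 t = ?R 3 t" if "t > 0" for t
    using ode[OF that] der[of 3 t] that by (simp add: iterated_deriv_def)
  have E2: "E 2 t = ?R 2 t" if "t > 0" for t
  proof -
    have "((\<lambda>t. E 2 t - ?R 2 t) has_real_derivative 0) (at t within {0<..})" if "t \<in> {0<..}" for t
      using DERIV_diff[OF E(2)[of 2 t] R[of t 2 lam]] E3[of t] that
      by (simp add: numeral_3_eq_3 numeral_2_eq_2 has_field_derivative_at_within)
    from has_field_derivative_zero_constant[OF _ this] obtain c
      where c: "\<And>t. t > 0 \<Longrightarrow> E 2 t - ?R 2 t = c" by (auto simp: convex_real_interval)
    have "E 2 1 = ?R 2 1" using bc der[of 2 1] by (simp add: iterated_deriv_def)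
    then show ?thesis using c[of 1] c[OF that] by simp
  qed
  \<comment> \<open>The witnesses \<open>D\<close> on the closed and \<open>E\<close> on the open
    half-line are chosen independently; uniqueness of derivatives glues them.\<close>
  have E1: "D 1 t = E 1 t" if "t > 0" for t
  proof -
    have "(D 0 has_real_derivative D 1 t) (at t)"
      using D(2)[of t] that by (simp add: at_within_atLeast_eq_at)
    moreover have "(D 0 has_real_derivative E 1 t) (at t)"
      by (rule has_field_derivative_transform_within_open[of "E 0" _ _ "{0<..}"])
        (use E(2)[of 0 t] E(1) D(1) that in auto)
    ultimately show ?thesis by (rule DERIV_unique)
  qed
  have "D 1 0 = 0"
  proof (rule has_field_derivative_unique)
    show "(y has_real_derivative D 1 0) (at 0 within {0..})"
      using D(1) unfolding has_field_derivative_def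
      by (intro has_derivative_transform[OF _ _ D(2)[unfolded has_field_derivative_def]]) auto
    \<comment> \<open>One-sided derivatives are unique because 0 is a limit point of the
      half-line.\<close>
    have "{0..} - {0} = {0::real<..}" by auto
    then show "at (0::real) within {0..} \<noteq> bot" by (simp add: at_within_eq_bot_iff)
  qed (rule y0)
  then have D1: "D 1 t = ?R 1 t" if "t \<ge> 0" for t
  proof (intro eq_if_same_derivative[OF D(4) continuous_on_iterated_deriv(1)[OF y] _ _ _ that])
    show "D 1 0 = ?R 1 0" using \<open>D 1 0 = 0\<close> by (simp add: iterated_deriv_def double_int_def)
    show "(D 1 has_real_derivative ?R 2 t) (at t)" if "t > 0" for t
      by (rule has_field_derivative_transform_within_open[of "E 1" _ _ "{0<..}"])
        (use E(2)[of 1 t] E1 E2 that in \<open>auto simp: numeral_2_eq_2\<close>)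
    show "(?R 1 has_real_derivative ?R 2 t) (at t)" if "t > 0" for t
      using R[OF that, of 1 lam] by (simp add: numeral_2_eq_2)
  qed simp
  have "D 0 t = ?R 0 t" if "t \<ge> 0" for t
  proof (rule eq_if_same_derivative[OF D(3) continuous_on_iterated_deriv(1)[OF y] _ _ _ that])
    show "D 0 0 = ?R 0 0" using D(1)[of 0] y0 by (simp add: iterated_deriv_def triple_int_def)
    show "(D 0 has_real_derivative ?R 1 t) (at t)" if "t > 0" for t
      using D(2)[of t] D1[of t] that by (simp add: at_within_atLeast_eq_at)
    show "(?R 0 has_real_derivative ?R 1 t) (at t)" if "t > 0" for t
      using R[OF that, of 0 lam] by simp
  qed simp
  then show ?thesis
    using y D(1) by (auto simp: is_iterated_solution_def iterated_deriv_def)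
qed

theorem theorem2p2:
  fixes lam :: real and y :: "real \<Rightarrow> real"
  shows "is_ode_solution lam y \<longleftrightarrow> is_volterra_solution lam y"
  using ode_imp_iterated iterated_imp_ode volterra_iff_iterated by blast

end
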